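(* Let $d\ge2$, $m\ge1$ and let $\mathcal{X}_1,\ldots,\mathcal{X}_m$ be any $m$ quantum channels on $\mathbb{C}^{d\times d}$ such that $$\sum_{i=1}^m \arccos\sqrt{\chi_{00}^{\mathcal{X}_i}} \leq \frac{\pi}{2}.$$ Then the $\chi_{00}$ element of the composite channel $\mathcal{X}_{1:m}=\mathcal{X}_1\cdots\mathcal{X}_m$ satisfies $$\chi_{00}^{\mathcal{X}_{1:m}} \geq \cos^2\left(\sum_{i=1}^m \arccos\sqrt{\chi_{00}^{\mathcal{X}_i}}\right).$$ Furthermore, this bound is saturated for all even dimensions and all values of the $\chi_{00}^{\mathcal{X}_i}$ satisfying $\sum_{i=1}^m \arccos\sqrt{\chi_{00}^{\mathcal{X}_i}} \leq \frac{\pi}{2}$: for every even $d$ and all $a_1,\ldots,a_m\in[0,1]$ with $\sum_{i}\arccos\sqrt{a_i}\le\pi/2$, there exist quantum channels $\mathcal{X}_1,\ldots,\mathcal{X}_m$ on $\mathbb{C}^{d\times d}$ with $\chi_{00}^{\mathcal{X}_i}=a_i$ for all $i$ and $\chi_{00}^{\mathcal{X}_{1:m}}=\cos^2\left(\sum_{i}\arccos\sqrt{a_i}\right)$.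
   Context: A quantum channel on $\mathbb{C}^{d\times d}$ is a completely positive trace-preserving linear map $\mathcal{E}:\mathbb{C}^{d\times d}\to\mathbb{C}^{d\times d}$. It can be written $\mathcal{E}(\rho)=\sum_j A_j\rho A_j^\dagger$ with Kraus operators $A_j\in\mathbb{C}^{d\times d}$, $\sum_j A_j^\dagger A_j=\mathbb{I}_d$. Products of channels denote composition: $\mathcal{A}\mathcal{B}(\rho)=\mathcal{A}[\mathcal{B}(\rho)]$. Let $B_0=\mathbb{I}_d/\sqrt d, B_1,\ldots,B_{d^2-1}$ be a trace-orthonormal basis of $\mathbb{C}^{d\times d}$ ($\mathrm{Tr}\,B_j^\dagger B_k=\delta_{jk}$). The $\chi$-matrix of $\mathcal{E}$ is defined by $\mathcal{E}(\rho)=d\sum_{k,l=0}^{d^2-1}\chi_{kl}^{\mathcal{E}}B_k\rho B_l^\dagger$. Its $(0,0)$ entry is $\chi_{00}^{\mathcal{E}}=\frac{1}{d^2}\sum_j|\mathrm{Tr}\,A_j|^2\in[0,1]$, independent of the choice of Kraus operators. *)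

theory Defs
  imports "HOL-Analysis.Analysis"
begin

text \<open>
  The space of complex \<open>d \<times> d\<close> matrices is rendered as \<open>complex^'d^'d\<close> with \<open>d = CARD('d)\<close>.
\<close>

type_synonym 'd cmat = "complex^'d^'d"

definition cscale :: "complex \<Rightarrow> 'd::finite cmat \<Rightarrow> 'd cmat" where
  "cscale c A = map_matrix (\<lambda>x. c * x) A"

definition dagger :: "'d::finite cmat \<Rightarrow> 'd cmat" where
  "dagger A = map_matrix cnj (transpose A)"

lemma cscale_nth [simp]: "cscale c A $ a $ b = c * A $ a $ b"
  by (simp add: cscale_def)

lemma dagger_nth [simp]: "dagger A $ a $ b = cnj (A $ b $ a)"
  by (simp add: dagger_def transpose_def)

lemma vector_space_cscale: "vector_space cscale"
  by unfold_locales (auto simp: vec_eq_iff algebra_simps)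

text \<open>
  A family \<open>M i j\<close> (\<open>i, j < n\<close>) of \<open>d \<times> d\<close> matrices stands for the block matrix
  \<open>(M i j)\<close>, i.e. for an element of the tensor product of the \<open>n \<times> n\<close> and the \<open>d \<times> d\<close>
  matrices; a vector of \<open>n d\<close> complex entries is likewise given by \<open>n\<close> blocks \<open>v i\<close>. Over the
  complex numbers, nonnegativity of the quadratic form on all vectors entails that
  the block matrix is Hermitian.
\<close>

definition block_psd :: "nat \<Rightarrow> (nat \<Rightarrow> nat \<Rightarrow> 'd::finite cmat) \<Rightarrow> bool" where
  "block_psd n M \<longleftrightarrow>
     (\<forall>v :: nat \<Rightarrow> complex^'d.
        (\<Sum>i<n. \<Sum>j<n. \<Sum>a\<in>UNIV. cnj (v i $ a) * (M i j *v v j) $ a) \<in> \<real>\<^sub>\<ge>\<^sub>0)"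

text \<open>
  \<open>\<lambda>i j. E (M i j)\<close> is the image of \<open>M\<close> under the tensor product of the identity map on
  \<open>n \<times> n\<close> matrices with \<open>E\<close>.
\<close>

definition completely_positive :: "('d::finite cmat \<Rightarrow> 'd cmat) \<Rightarrow> bool" where
  "completely_positive E \<longleftrightarrow>
     (\<forall>n M. block_psd n M \<longrightarrow> block_psd n (\<lambda>i j. E (M i j)))"

definition trace_preserving :: "('d::finite cmat \<Rightarrow> 'd cmat) \<Rightarrow> bool" where
  "trace_preserving E \<longleftrightarrow> (\<forall>\<rho>. trace (E \<rho>) = trace \<rho>)"

definition quantum_channel :: "('d::finite cmat \<Rightarrow> 'd cmat) \<Rightarrow> bool" where
  "quantum_channel E \<longleftrightarrow>
     Vector_Spaces.linear cscale cscale E \<and> completely_positive E \<and> trace_preserving E"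

text \<open>\<open>compose_channels X m = X 1 \<circ> X 2 \<circ> \<dots> \<circ> X m\<close>, so \<open>X m\<close> acts first.\<close>

primrec compose_channels :: "(nat \<Rightarrow> 'd::finite cmat \<Rightarrow> 'd cmat) \<Rightarrow> nat \<Rightarrow> 'd cmat \<Rightarrow> 'd cmat" where
  "compose_channels X 0 = id"
| "compose_channels X (Suc m) = compose_channels X m \<circ> X (Suc m)"

text \<open>
  Being \<open>d\<^sup>2\<close> orthonormal elements of a \<open>d\<^sup>2\<close>-dimensional space, the \<open>B k\<close> with
  \<open>k < d\<^sup>2\<close> form a basis. Values \<open>B k\<close> with \<open>k \<ge> d\<^sup>2\<close> are irrelevant.
\<close>

definition trace_orthonormal_basis :: "(nat \<Rightarrow> 'd::finite cmat) \<Rightarrow> bool" where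
  "trace_orthonormal_basis B \<longleftrightarrow>
     B 0 = cscale (1 / complex_of_real (sqrt (real CARD('d)))) (mat 1) \<and>
     (\<forall>j < CARD('d)\<^sup>2. \<forall>k < CARD('d)\<^sup>2.
        trace (dagger (B j) ** B k) = (if j = k then 1 else 0))"

text \<open>
  The entries outside the index range are fixed to \<open>0\<close> to make the matrix unique as a
  function on all of \<open>nat\<close>; see \<open>ex1_chi_matrix\<close> below.
\<close>

definition is_chi_matrix ::
    "(nat \<Rightarrow> 'd::finite cmat) \<Rightarrow> ('d cmat \<Rightarrow> 'd cmat) \<Rightarrow> (nat \<Rightarrow> nat \<Rightarrow> complex) \<Rightarrow> bool" where
  "is_chi_matrix B E chi \<longleftrightarrow>
     (\<forall>\<rho>. E \<rho> = cscale (of_nat CARD('d))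
        (\<Sum>k<CARD('d)\<^sup>2. \<Sum>l<CARD('d)\<^sup>2. cscale (chi k l) (B k ** \<rho> ** dagger (B l)))) \<and>
     (\<forall>k l. k \<ge> CARD('d)\<^sup>2 \<or> l \<ge> CARD('d)\<^sup>2 \<longrightarrow> chi k l = 0)"

definition chi_matrix ::
    "(nat \<Rightarrow> 'd::finite cmat) \<Rightarrow> ('d cmat \<Rightarrow> 'd cmat) \<Rightarrow> nat \<Rightarrow> nat \<Rightarrow> complex" where
  "chi_matrix B E = (THE chi. is_chi_matrix B E chi)"

lemma trace_dagger_mult:
  "trace (dagger A ** B) = (\<Sum>p\<in>UNIV. cnj (A $ fst p $ snd p) * B $ fst p $ snd p)"
proof -
  have "trace (dagger A ** B) = (\<Sum>c\<in>UNIV. \<Sum>a\<in>UNIV. cnj (A $ a $ c) * B $ a $ c)"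
    by (simp add: trace_def matrix_matrix_mult_def)
  also have "\<dots> = (\<Sum>a\<in>UNIV. \<Sum>c\<in>UNIV. cnj (A $ a $ c) * B $ a $ c)"
    by (rule sum.swap)
  also have "\<dots> = (\<Sum>p\<in>UNIV. cnj (A $ fst p $ snd p) * B $ fst p $ snd p)"
    by (simp add: sum.cartesian_product case_prod_unfold)
  finally show ?thesis .
qed

lemma trace_orthonormal_basis_complete:
  fixes B :: "nat \<Rightarrow> 'd::finite cmat" and p q :: "'d \<times> 'd"
  assumes "trace_orthonormal_basis B"
  shows "(\<Sum>k<CARD('d)\<^sup>2. cnj (B k $ fst p $ snd p) * B k $ fst q $ snd q) =
         (if p = q then 1 else 0)"
proof -
  have "card (UNIV :: ('d \<times> 'd) set) = card {..<CARD('d)\<^sup>2}"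
    by (simp add: power2_eq_square)
  then obtain h where h: "bij_betw h (UNIV :: ('d \<times> 'd) set) {..<CARD('d)\<^sup>2}"
    using finite_same_card_bij[of "UNIV :: ('d \<times> 'd) set" "{..<CARD('d)\<^sup>2}"] by auto
  have h_lt: "h r < CARD('d)\<^sup>2" for r using h by (auto simp: bij_betw_def)
  have h_eq: "h r = h s \<longleftrightarrow> r = s" for r s
    using h by (metis bij_betw_imp_inj_on inj_eq)
  define U :: "complex^('d \<times> 'd)^('d \<times> 'd)"
    where "U = (\<chi> r s. cnj (B (h r) $ fst s $ snd s))"
  define V :: "complex^('d \<times> 'd)^('d \<times> 'd)"
    where "V = (\<chi> s r. B (h r) $ fst s $ snd s)"
  have orth: "(\<Sum>t\<in>UNIV. cnj (B (h r) $ fst t $ snd t) * B (h s) $ fst t $ snd t) =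
      (if r = s then 1 else 0)" for r s
    using assms h_lt unfolding trace_orthonormal_basis_def trace_dagger_mult h_eq[symmetric] by blast
  have "U ** V = mat 1"
    by (simp add: vec_eq_iff matrix_matrix_mult_def U_def V_def mat_def orth)
  then have "V ** U = mat 1" by (simp add: matrix_left_right_inverse)
  then have "(V ** U) $ q $ p = (if q = p then 1 else 0)" by (simp add: mat_def)
  then have "(\<Sum>r\<in>UNIV. cnj (B (h r) $ fst p $ snd p) * B (h r) $ fst q $ snd q) =
      (if p = q then 1 else 0)"
    by (simp add: matrix_matrix_mult_def U_def V_def mult.commute eq_commute[of q p])
  then show ?thesis using sum.reindex_bij_betw[OF h, of "\<lambda>k. cnj (B k $ fst p $ snd p) * B k $ fst q $ snd q"] by simp
qed

lemma sandwich_nth: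
  "(A ** \<rho> ** dagger C) $ a $ b = (\<Sum>c\<in>UNIV. \<Sum>e\<in>UNIV. \<rho> $ c $ e * (A $ a $ c * cnj (C $ b $ e)))"
proof -
  have "(A ** \<rho> ** dagger C) $ a $ b = (\<Sum>e\<in>UNIV. \<Sum>c\<in>UNIV. \<rho> $ c $ e * (A $ a $ c * cnj (C $ b $ e)))"
    by (simp add: matrix_matrix_mult_def sum_distrib_left sum_distrib_right ac_simps)
  also have "\<dots> = (\<Sum>c\<in>UNIV. \<Sum>e\<in>UNIV. \<rho> $ c $ e * (A $ a $ c * cnj (C $ b $ e)))"
    by (rule sum.swap)
  finally show ?thesis .
qed

definition eunit :: "'d \<Rightarrow> 'd \<Rightarrow> 'd::finite cmat" where
  "eunit c e = (\<chi> i j. if i = c \<and> j = e then 1 else 0)"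

lemma eunit_sum: "\<rho> = (\<Sum>c\<in>UNIV. \<Sum>e\<in>UNIV. cscale (\<rho> $ c $ e) (eunit c e))"
proof -
  have "(\<Sum>e\<in>UNIV. \<rho> $ c $ e * (if a = c \<and> b = e then 1 else 0)) = (if a = c then \<rho> $ c $ b else 0)" for a b c
    by (cases "a = c") (simp_all add: if_distrib cong: if_cong)
  then show ?thesis by (simp add: vec_eq_iff sum_component eunit_def)
qed

lemma linear_nth:
  assumes "Vector_Spaces.linear cscale cscale E"
  shows "E \<rho> $ a $ b = (\<Sum>c\<in>UNIV. \<Sum>e\<in>UNIV. \<rho> $ c $ e * E (eunit c e) $ a $ b)"
proof -
  interpret E: Vector_Spaces.linear cscale cscale E by fact
  have "E \<rho> = (\<Sum>c\<in>UNIV. \<Sum>e\<in>UNIV. cscale (\<rho> $ c $ e) (E (eunit c e)))"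
    by (subst eunit_sum[of \<rho>]) (simp add: E.sum E.scale)
  then show ?thesis by (simp add: sum_component)
qed

lemma sandwich_eunit: "(A ** eunit c e ** dagger C) $ a $ b = A $ a $ c * cnj (C $ b $ e)"
proof -
  have "(\<Sum>e'\<in>UNIV. eunit c e $ c' $ e' * (A $ a $ c' * cnj (C $ b $ e'))) = (if c' = c then A $ a $ c' * cnj (C $ b $ e) else 0)" for c'
    by (cases "c' = c") (simp_all add: eunit_def if_distrib[of "\<lambda>x. x * _"] cong: if_cong)
  then show ?thesis by (simp add: sandwich_nth)
qed

lemma chi_expansion_iff:
  fixes B :: "nat \<Rightarrow> 'd::finite cmat"
  assumes "Vector_Spaces.linear cscale cscale E"
  shows "(\<forall>\<rho>. E \<rho> = cscale (of_nat CARD('d))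
        (\<Sum>k<CARD('d)\<^sup>2. \<Sum>l<CARD('d)\<^sup>2. cscale (chi k l) (B k ** \<rho> ** dagger (B l)))) \<longleftrightarrow>
     (\<forall>p q :: 'd \<times> 'd. E (eunit (snd p) (snd q)) $ fst p $ fst q / of_nat CARD('d) =
       (\<Sum>k<CARD('d)\<^sup>2. \<Sum>l<CARD('d)\<^sup>2. chi k l * (B k $ fst p $ snd p * cnj (B l $ fst q $ snd q))))"
    (is "?L = ?R")
proof
  assume L: ?L
  show ?R
    by (subst L[rule_format]) (auto simp: sum_component sandwich_eunit)
next
  assume R: ?R
  have R': "E (eunit c e) $ a $ b = of_nat CARD('d) *
      (\<Sum>k<CARD('d)\<^sup>2. \<Sum>l<CARD('d)\<^sup>2. chi k l * (B k $ a $ c * cnj (B l $ b $ e)))" for a b c e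
    using R[rule_format, of "(a,c)" "(b,e)"] by (simp add: field_simps)
  show ?L
  proof
    fix \<rho>
    have "E \<rho> $ a $ b = (cscale (of_nat CARD('d))
        (\<Sum>k<CARD('d)\<^sup>2. \<Sum>l<CARD('d)\<^sup>2. cscale (chi k l) (B k ** \<rho> ** dagger (B l)))) $ a $ b" for a b
    proof -
      have "E \<rho> $ a $ b = (\<Sum>c\<in>UNIV. \<Sum>e\<in>UNIV. \<Sum>k<CARD('d)\<^sup>2. \<Sum>l<CARD('d)\<^sup>2.
          of_nat CARD('d) * (chi k l * (\<rho> $ c $ e * (B k $ a $ c * cnj (B l $ b $ e)))))"
        unfolding linear_nth[OF assms, of \<rho>] R' by (simp add: sum_distrib_left ac_simps)
      also have "\<dots> = (\<Sum>c\<in>UNIV. \<Sum>k<CARD('d)\<^sup>2. \<Sum>l<CARD('d)\<^sup>2. \<Sum>e\<in>UNIV.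
          of_nat CARD('d) * (chi k l * (\<rho> $ c $ e * (B k $ a $ c * cnj (B l $ b $ e)))))"
        by (intro sum.cong refl, subst sum.swap, intro sum.cong refl, rule sum.swap)
      also have "\<dots> = (\<Sum>k<CARD('d)\<^sup>2. \<Sum>l<CARD('d)\<^sup>2. \<Sum>c\<in>UNIV. \<Sum>e\<in>UNIV.
          of_nat CARD('d) * (chi k l * (\<rho> $ c $ e * (B k $ a $ c * cnj (B l $ b $ e)))))"
        by (subst sum.swap, intro sum.cong refl, rule sum.swap)
      finally show ?thesis by (simp add: sum_component sandwich_nth sum_distrib_left)
    qed
    then show "E \<rho> = cscale (of_nat CARD('d))
        (\<Sum>k<CARD('d)\<^sup>2. \<Sum>l<CARD('d)\<^sup>2. cscale (chi k l) (B k ** \<rho> ** dagger (B l)))"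
      by (simp only: vec_eq_iff) blast
  qed
qed

lemma change_of_basis:
  fixes x :: "'k \<Rightarrow> 'k \<Rightarrow> complex" and u :: "'k \<Rightarrow> 'p \<Rightarrow> complex"
  assumes "finite K" "finite P"
    and orth: "\<And>j k. j \<in> K \<Longrightarrow> k \<in> K \<Longrightarrow> (\<Sum>p\<in>P. cnj (u j p) * u k p) = (if j = k then 1 else 0)"
    and y: "\<And>p q. p \<in> P \<Longrightarrow> q \<in> P \<Longrightarrow> y p q = (\<Sum>k\<in>K. \<Sum>l\<in>K. x k l * (u k p * cnj (u l q)))"
    and "i \<in> K" "j \<in> K"
  shows "(\<Sum>p\<in>P. \<Sum>q\<in>P. y p q * (cnj (u i p) * u j q)) = x i j"
proof -
  have orth': "(\<Sum>q\<in>P. cnj (u l q) * u j q) = (if l = j then 1 else 0)" if "l \<in> K" for l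
    using orth that \<open>j \<in> K\<close> by auto
  have "(\<Sum>q\<in>P. y p q * (cnj (u i p) * u j q)) = (\<Sum>k\<in>K. x k j * (cnj (u i p) * u k p))" if "p \<in> P" for p
  proof -
    have "(\<Sum>q\<in>P. y p q * (cnj (u i p) * u j q)) =
        (\<Sum>q\<in>P. \<Sum>k\<in>K. \<Sum>l\<in>K. x k l * (cnj (u i p) * u k p) * (cnj (u l q) * u j q))"
      using that by (simp add: y sum_distrib_left sum_distrib_right ac_simps)
    also have "\<dots> = (\<Sum>k\<in>K. \<Sum>l\<in>K. \<Sum>q\<in>P. x k l * (cnj (u i p) * u k p) * (cnj (u l q) * u j q))"
      by (subst sum.swap, intro sum.cong refl, rule sum.swap)
    also have "\<dots> = (\<Sum>k\<in>K. \<Sum>l\<in>K. x k l * (cnj (u i p) * u k p) * (if l = j then 1 else 0))"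
      by (simp add: sum_distrib_left[symmetric] orth')
    also have "\<dots> = (\<Sum>k\<in>K. x k j * (cnj (u i p) * u k p))"
      using assms by (simp add: if_distrib cong: if_cong)
    finally show ?thesis .
  qed
  then have "(\<Sum>p\<in>P. \<Sum>q\<in>P. y p q * (cnj (u i p) * u j q)) =
      (\<Sum>p\<in>P. \<Sum>k\<in>K. x k j * (cnj (u i p) * u k p))" by simp
  also have "\<dots> = (\<Sum>k\<in>K. x k j * (\<Sum>p\<in>P. cnj (u i p) * u k p))"
    by (subst sum.swap) (simp add: sum_distrib_left)
  also have "\<dots> = (\<Sum>k\<in>K. x k j * (if i = k then 1 else 0))"
    using \<open>i \<in> K\<close> by (simp add: orth)
  also have "\<dots> = x i j" using assms by (simp add: if_distrib cong: if_cong)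
  finally show ?thesis .
qed

lemma ex1_chi_matrix:
  fixes B :: "nat \<Rightarrow> 'd::finite cmat"
  assumes B: "trace_orthonormal_basis B" and E: "Vector_Spaces.linear cscale cscale E"
  shows "\<exists>!chi. is_chi_matrix B E chi"
proof -
  define K where "K = {..<CARD('d)\<^sup>2}"
  define u where "u k p = B k $ fst p $ snd p" for k and p :: "'d \<times> 'd"
  define y where "y p q = E (eunit (snd p) (snd q)) $ fst p $ fst q / of_nat CARD('d)" for p q :: "'d \<times> 'd"
  have orth: "(\<Sum>p\<in>UNIV. cnj (u j p) * u k p) = (if j = k then 1 else 0)" if "j \<in> K" "k \<in> K" for j k
    using B that unfolding trace_orthonormal_basis_def trace_dagger_mult u_def K_def by auto
  have compl: "(\<Sum>k\<in>K. cnj (u k p) * u k q) = (if p = q then 1 else 0)" for p q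
    using trace_orthonormal_basis_complete[OF B] unfolding u_def K_def by auto
  have iff: "is_chi_matrix B E chi \<longleftrightarrow>
      (\<forall>p q. y p q = (\<Sum>k\<in>K. \<Sum>l\<in>K. chi k l * (u k p * cnj (u l q)))) \<and>
      (\<forall>k l. k \<notin> K \<or> l \<notin> K \<longrightarrow> chi k l = 0)" for chi
    unfolding is_chi_matrix_def chi_expansion_iff[OF E] y_def u_def K_def by (simp add: not_less)
  define chi0 where "chi0 k l = (if k \<in> K \<and> l \<in> K then \<Sum>p\<in>UNIV. \<Sum>q\<in>UNIV. y p q * (cnj (u k p) * u l q) else 0)" for k l
  show ?thesis
  proof (rule ex1I[of _ chi0])
    have "y p q = (\<Sum>k\<in>K. \<Sum>l\<in>K. chi0 k l * (u k p * cnj (u l q)))" for p q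
    proof -
      have "(\<Sum>k\<in>K. \<Sum>l\<in>K. chi0 k l * (cnj (cnj (u k p)) * cnj (u l q))) = y p q"
      proof (rule change_of_basis[where K = UNIV and P = K and u = "\<lambda>p k. cnj (u k p)"])
        fix p q show "(\<Sum>k\<in>K. cnj (cnj (u k p)) * cnj (u k q)) = (if p = q then 1 else 0)"
          using compl[of q p] by (simp add: mult.commute eq_commute[of q p])
      qed (auto simp: chi0_def K_def)
      then show ?thesis by simp
    qed
    moreover have "chi0 k l = 0" if "k \<notin> K \<or> l \<notin> K" for k l
      using that by (auto simp: chi0_def)
    ultimately show "is_chi_matrix B E chi0" unfolding iff by blast
  next
    fix chi assume "is_chi_matrix B E chi"
    then have c: "y p q = (\<Sum>k\<in>K. \<Sum>l\<in>K. chi k l * (u k p * cnj (u l q)))" "k \<notin> K \<or> l \<notin> K \<Longrightarrow> chi k l = 0" for p q k l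
      unfolding iff by blast+
    show "chi = chi0"
    proof (intro ext)
      fix k l
      show "chi k l = chi0 k l"
      proof (cases "k \<in> K \<and> l \<in> K")
        case True
        then have "(\<Sum>p\<in>UNIV. \<Sum>q\<in>UNIV. y p q * (cnj (u k p) * u l q)) = chi k l"
          by (intro change_of_basis[where K = K and P = UNIV and x = chi and u = u and y = y] orth c(1))
            (simp_all only: finite, simp_all add: K_def)
        then show ?thesis using True unfolding chi0_def by simp
      next
        case False then show ?thesis using c(2)[of k l] unfolding chi0_def by auto
      qed
    qed
  qed
qed

end

theory Submission
  imports Defs
begin

text \<open>
  For a channel with Kraus operators \<open>A\<^sub>j\<close>, a unitary mixing of the Kraus operators makes all of
  them traceless except \<open>A\<^sub>0\<close>, whose trace then is \<open>d \<surd>\<chi>\<^sub>0\<^sub>0\<close>. With \<open>B\<^sub>0\<close> chosen likewise for a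
  second channel, the composition satisfies \<open>\<chi>\<^sub>0\<^sub>0 \<ge> |Tr A\<^sub>0 B\<^sub>0|\<^sup>2 / d\<^sup>2\<close>. Splitting \<open>A\<^sub>0\<close> and \<open>B\<^sub>0\<close> into
  a multiple of the identity and a traceless part, and bounding the traceless parts by
  Cauchy-Schwarz, gives \<open>|Tr A\<^sub>0 B\<^sub>0| / d \<ge> \<surd>x \<surd>y - \<surd>(1 - x) \<surd>(1 - y)\<close> for the two
  \<open>\<chi>\<^sub>0\<^sub>0\<close> values \<open>x\<close> and \<open>y\<close>, which is the cosine of the sum of the two angles. Induction
  extends this to \<open>m\<close> channels.

  Kraus operators are avoided by working with Choi matrices: \<open>A\<^sub>0\<close> becomes the part of the Choi
  matrix \<open>J\<close> along \<open>J \<phi>\<close>, where \<open>\<phi>\<close> is the maximally entangled state, and the other Kraus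
  operators become the remainder, which is positive semidefinite.

  The bound is attained by conjugations with \<open>exp (i \<theta> Z)\<close>, where \<open>Z\<close> is diagonal with
  equally many entries \<open>1\<close> and \<open>-1\<close>: the angles \<open>\<theta>\<close> add up under composition.
\<close>

section \<open>Positive semidefinite matrices\<close>

text \<open>Matrices are plain functions of two indices, so that Choi matrices can be indexed by
  pairs and permuted by composition with a bijection.\<close>

definition sform :: "('n \<Rightarrow> 'n \<Rightarrow> complex) \<Rightarrow> ('n::finite \<Rightarrow> complex) \<Rightarrow> ('n \<Rightarrow> complex) \<Rightarrow> complex" where
  "sform P u v = (\<Sum>i\<in>UNIV. \<Sum>j\<in>UNIV. cnj (u i) * P i j * v j)"

definition psd :: "('n::finite \<Rightarrow> 'n \<Rightarrow> complex) \<Rightarrow> bool" where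
  "psd P \<longleftrightarrow> (\<forall>v. sform P v v \<in> \<real>\<^sub>\<ge>\<^sub>0)"

lemma sform_add_right: "sform P u (\<lambda>i. v i + w i) = sform P u v + sform P u w"
  by (simp add: sform_def distrib_left sum.distrib)

lemma sform_add_left: "sform P (\<lambda>i. u i + v i) w = sform P u w + sform P v w"
  by (simp add: sform_def distrib_right sum.distrib)

lemma sform_scale_right: "sform P u (\<lambda>i. c * v i) = c * sform P u v"
  by (simp add: sform_def sum_distrib_left ac_simps)

lemma sform_scale_left: "sform P (\<lambda>i. c * u i) v = cnj c * sform P u v"
  by (simp add: sform_def sum_distrib_left ac_simps)

lemma sform_add_scaled_self:
  "sform P (\<lambda>i. u i + c * v i) (\<lambda>i. u i + c * v i) =
     sform P u u + c * sform P u v + cnj c * sform P v u + cnj c * c * sform P v v"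
  by (simp add: sform_add_right sform_add_left sform_scale_right sform_scale_left algebra_simps)

lemma sform_diff_rank_one:
  "sform (\<lambda>i j. P i j - w i * cnj (w j)) u v =
     sform P u v - (\<Sum>i\<in>UNIV. cnj (u i) * w i) * cnj (\<Sum>i\<in>UNIV. cnj (v i) * w i)"
  unfolding sform_def sum_product cnj_sum
  by (simp add: algebra_simps sum_subtractf)

lemma sform_unit: "sform P (\<lambda>i. of_bool (i = k)) (\<lambda>i. of_bool (i = l)) = P k l"
proof -
  have "(\<Sum>j\<in>UNIV. cnj (of_bool (i = k)) * P i j * of_bool (j = l)) = (if i = k then P k l else 0)" for i
    by (cases "i = k") (simp_all add: of_bool_def if_distrib cong: if_cong)
  then show ?thesis by (simp add: sform_def)
qed

lemma psd_nonneg: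
  assumes "psd P"
  shows "0 \<le> Re (sform P v v)" "Im (sform P v v) = 0"
  using assms by (auto simp: psd_def complex_nonneg_Reals_iff)

lemma psd_sform_self: "psd P \<Longrightarrow> sform P v v = complex_of_real (Re (sform P v v))"
  by (simp add: complex_eq_iff psd_nonneg)

text \<open>Polarization: the form is real at \<open>u + v\<close> and at \<open>u + \<i> v\<close>,
  which forces \<open>P\<close> to be Hermitian.\<close>

lemma psd_sform_cnj:
  assumes "psd P"
  shows "sform P v u = cnj (sform P u v)"
proof -
  have "Im (sform P (\<lambda>i. u i + 1 * v i) (\<lambda>i. u i + 1 * v i)) = 0"
    "Im (sform P (\<lambda>i. u i + \<i> * v i) (\<lambda>i. u i + \<i> * v i)) = 0"
    using psd_nonneg(2)[OF assms] by blast+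
  then show ?thesis
    using psd_nonneg(2)[OF assms, of u] psd_nonneg(2)[OF assms, of v]
    unfolding sform_add_scaled_self by (simp add: complex_eq_iff)
qed

lemma psd_diag_nonneg:
  assumes "psd P"
  shows "0 \<le> Re (P k k)" "Im (P k k) = 0"
  using psd_nonneg[OF assms, of "\<lambda>i. of_bool (i = k)"] by (simp_all add: sform_unit)

lemma psd_diag_zero_imp_zero:
  assumes "psd P" "\<And>k. P k k = 0"
  shows "P k l = 0"
proof -
  define u :: "'a \<Rightarrow> complex" where "u = (\<lambda>i. of_bool (i = k))"
  define v :: "'a \<Rightarrow> complex" where "v = (\<lambda>i. of_bool (i = l))"
  define c where "c = sform P u v"
  have z: "sform P u u = 0" "sform P v v = 0"
    using assms(2) by (simp_all add: u_def v_def sform_unit)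
  have vu: "sform P v u = cnj c"
    unfolding c_def by (rule psd_sform_cnj[OF assms(1)])
  \<comment> \<open>The coefficient \<open>- cnj c\<close> makes each cross term equal to
    \<open>- c * cnj c\<close>, while both diagonal terms vanish.\<close>
  have "0 \<le> Re (sform P (\<lambda>i. u i + - cnj c * v i) (\<lambda>i. u i + - cnj c * v i))"
    by (rule psd_nonneg[OF assms(1)])
  also have "\<dots> = - (2 * ((Re c)\<^sup>2 + (Im c)\<^sup>2))"
    unfolding sform_add_scaled_self by (simp add: z vu power2_eq_square flip: c_def)
  finally have "(Re c)\<^sup>2 + (Im c)\<^sup>2 \<le> 0" by simp
  then have "c = 0"
    unfolding sum_power2_le_zero_iff by (simp add: complex_eq_iff)
  then show ?thesis by (simp add: c_def u_def v_def sform_unit)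
qed

lemma sform_reindex:
  assumes "bij h"
  shows "sform (\<lambda>i j. P (h i) (h j)) (\<lambda>i. u (h i)) (\<lambda>i. v (h i)) = sform P u v"
proof -
  have "(\<Sum>j\<in>UNIV. cnj (u i) * P i (h j) * v (h j)) = (\<Sum>j\<in>UNIV. cnj (u i) * P i j * v j)" for i
    by (rule sum.reindex_bij_betw[OF assms])
  then show ?thesis
    unfolding sform_def
    using sum.reindex_bij_betw[OF assms, of "\<lambda>i. \<Sum>j\<in>UNIV. cnj (u i) * P i j * v j"] by simp
qed

lemma psd_reindex:
  assumes "psd P" and h: "bij h"
  shows "psd (\<lambda>i j. P (h i) (h j))"
  unfolding psd_def
proof
  fix v
  have "sform (\<lambda>i j. P (h i) (h j)) v v = sform P (v \<circ> inv h) (v \<circ> inv h)"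
    using sform_reindex[OF h, of P "v \<circ> inv h" "v \<circ> inv h"] h by (simp add: bij_is_inj)
  then show "sform (\<lambda>i j. P (h i) (h j)) v v \<in> \<real>\<^sub>\<ge>\<^sub>0"
    using assms(1) by (simp add: psd_def)
qed

text \<open>
  For \<open>w = rank_one_part P f\<close> the difference \<open>P - w w\<^sup>*\<close> annihilates \<open>f\<close>. If
  \<open>sform P f f = 0\<close>, division by zero gives \<open>w = 0\<close>, which is the right value.
\<close>

definition rank_one_part :: "('n::finite \<Rightarrow> 'n \<Rightarrow> complex) \<Rightarrow> ('n \<Rightarrow> complex) \<Rightarrow> 'n \<Rightarrow> complex" where
  "rank_one_part P f i = (\<Sum>j\<in>UNIV. P i j * f j) / complex_of_real (sqrt (Re (sform P f f)))"

lemma inner_rank_one_part: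
  "(\<Sum>i\<in>UNIV. cnj (v i) * rank_one_part P f i) =
     sform P v f / complex_of_real (sqrt (Re (sform P f f)))"
  by (simp add: rank_one_part_def sform_def sum_divide_distrib sum_distrib_left mult.assoc)

text \<open>Completing the square: the new form at \<open>v\<close> is the old form at the component
  of \<open>v\<close> that is orthogonal to \<open>f\<close> with respect to
  \<open>P\<close>.\<close>

lemma psd_diff_rank_one_part:
  assumes P: "psd P"
  shows "psd (\<lambda>i j. P i j - rank_one_part P f i * cnj (rank_one_part P f j))"
  unfolding psd_def
proof
  fix v
  define q where "q = Re (sform P f f)"
  define c where "c = sform P v f"
  have ff: "sform P f f = complex_of_real q"
    unfolding q_def by (rule psd_sform_self[OF P])
  have q: "0 \<le> q" unfolding q_def by (rule psd_nonneg[OF P])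
  have fv: "sform P f v = cnj c" unfolding c_def by (rule psd_sform_cnj[OF P])
  have eq: "sform (\<lambda>i j. P i j - rank_one_part P f i * cnj (rank_one_part P f j)) v v =
      sform P v v - c * cnj c / complex_of_real q"
    using q unfolding sform_diff_rank_one inner_rank_one_part
    by (simp flip: q_def c_def of_real_mult)
  show "sform (\<lambda>i j. P i j - rank_one_part P f i * cnj (rank_one_part P f j)) v v \<in> \<real>\<^sub>\<ge>\<^sub>0"
  proof (cases "q = 0")
    case True
    then show ?thesis using P unfolding eq by (simp add: psd_def)
  next
    case False
    define t where "t = - (cnj c / complex_of_real q)"
    have "sform P (\<lambda>i. v i + t * f i) (\<lambda>i. v i + t * f i) = sform P v v - c * cnj c / complex_of_real q"
      using False unfolding sform_add_scaled_self by (simp add: ff fv t_def field_simps flip: c_def)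
    then show ?thesis using P unfolding eq psd_def by metis
  qed
qed

text \<open>
  Cholesky elimination: splitting off the rank-one part of \<open>P\<close> at a basis vector kills
  a nonzero diagonal entry and creates no new one.
\<close>

lemma psd_hadamard_sum_nonneg:
  fixes P Q :: "'n::finite \<Rightarrow> 'n \<Rightarrow> complex"
  assumes "psd P" and Q: "psd Q"
  shows "0 \<le> Re (\<Sum>i\<in>UNIV. \<Sum>j\<in>UNIV. P i j * Q i j)"
  using \<open>psd P\<close>
proof (induction "card {k. P k k \<noteq> 0}" arbitrary: P rule: less_induct)
  case less
  show ?case
  proof (cases "\<exists>k. P k k \<noteq> 0")
    case False
    then show ?thesis using psd_diag_zero_imp_zero[OF less.prems] by simp
  next
    case True
    then obtain k where k: "P k k \<noteq> 0" by blast
    define w where "w = rank_one_part P (\<lambda>i. of_bool (i = k))"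
    define R where "R i j = P i j - w i * cnj (w j)" for i j
    have R: "psd R"
      unfolding R_def w_def by (rule psd_diff_rank_one_part[OF less.prems])
    have "w k = P k k / complex_of_real (sqrt (Re (P k k)))"
      unfolding w_def rank_one_part_def sform_unit
      by (simp add: of_bool_def if_distrib cong: if_cong)
    moreover have Pk: "P k k = complex_of_real (Re (P k k))" "0 \<le> Re (P k k)"
      using psd_diag_nonneg[OF less.prems, of k] by (simp_all add: complex_eq_iff)
    ultimately have "w k = complex_of_real (sqrt (Re (P k k)))"
      by (metis of_real_divide real_div_sqrt)
    then have "w k * cnj (w k) = P k k"
      using Pk by (simp flip: of_real_mult)
    then have "R k k = 0" by (simp add: R_def)
    \<comment> \<open>No new nonzero entry can arise: \<open>R l l\<close> is nonnegative and also
      minus a square.\<close>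
    moreover have "R l l = 0" if "P l l = 0" for l
    proof -
      have "R l l = - complex_of_real ((cmod (w l))\<^sup>2)"
        using that by (simp add: R_def complex_norm_square del: of_real_power)
      with psd_diag_nonneg(1)[OF R, of l] show ?thesis by simp
    qed
    ultimately have "{l. R l l \<noteq> 0} \<subset> {l. P l l \<noteq> 0}" using k by blast
    then have "card {l. R l l \<noteq> 0} < card {l. P l l \<noteq> 0}"
      by (intro psubset_card_mono) auto
    then have "0 \<le> Re (\<Sum>i\<in>UNIV. \<Sum>j\<in>UNIV. R i j * Q i j)"
      using R less.hyps by blast
    \<comment> \<open>The part split off contributes a value of the form of \<open>Q\<close>, which
      is nonnegative.\<close>
    moreover have "(\<Sum>i\<in>UNIV. \<Sum>j\<in>UNIV. P i j * Q i j) =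
        (\<Sum>i\<in>UNIV. \<Sum>j\<in>UNIV. R i j * Q i j) + sform Q (\<lambda>i. cnj (w i)) (\<lambda>i. cnj (w i))"
      by (simp add: sform_def R_def algebra_simps flip: sum.distrib)
    ultimately show ?thesis
      using psd_nonneg(1)[OF Q, of "\<lambda>i. cnj (w i)"] by simp
  qed
qed

lemma psd_rank_one: "psd (\<lambda>i j. w i * cnj (w j))"
proof -
  have "sform (\<lambda>i j. w i * cnj (w j)) v v = (\<Sum>i\<in>UNIV. cnj (v i) * w i) * cnj (\<Sum>i\<in>UNIV. cnj (v i) * w i)" for v
    unfolding sform_def sum_product cnj_sum by (simp add: ac_simps)
  then show ?thesis
    by (simp only: psd_def complex_norm_square[symmetric]) simp
qed

text \<open>Split both matrices into rank-one part and remainder: the terms with a remainder are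
  nonnegative, and the product of the rank-one parts is the square on the left. For Choi matrices
  this square plays the role of \<open>|Tr A\<^sub>0 B\<^sub>0|\<^sup>2 / d\<^sup>2\<close>.\<close>

lemma psd_hadamard_sum_ge:
  fixes P Q :: "'n::finite \<Rightarrow> 'n \<Rightarrow> complex"
  assumes P: "psd P" and Q: "psd Q"
  shows "(cmod (\<Sum>i\<in>UNIV. rank_one_part P f i * rank_one_part Q g i))\<^sup>2
           \<le> Re (\<Sum>i\<in>UNIV. \<Sum>j\<in>UNIV. P i j * Q i j)"
proof -
  define w where "w = rank_one_part P f"
  define z where "z = rank_one_part Q g"
  define R where "R i j = P i j - w i * cnj (w j)" for i j
  define S where "S i j = Q i j - z i * cnj (z j)" for i j
  have "psd R" "psd S"
    unfolding R_def S_def w_def z_def by (rule psd_diff_rank_one_part[OF P] psd_diff_rank_one_part[OF Q])+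
  then have "0 \<le> Re (\<Sum>i\<in>UNIV. \<Sum>j\<in>UNIV. R i j * Q i j)"
    "0 \<le> Re (\<Sum>i\<in>UNIV. \<Sum>j\<in>UNIV. w i * cnj (w j) * S i j)"
    using psd_hadamard_sum_nonneg Q psd_rank_one by blast+
  moreover have "(\<Sum>i\<in>UNIV. \<Sum>j\<in>UNIV. P i j * Q i j) = (\<Sum>i\<in>UNIV. \<Sum>j\<in>UNIV. R i j * Q i j)
      + (\<Sum>i\<in>UNIV. \<Sum>j\<in>UNIV. w i * cnj (w j) * S i j)
      + (\<Sum>i\<in>UNIV. w i * z i) * cnj (\<Sum>i\<in>UNIV. w i * z i)"
    unfolding sum_product cnj_sum by (simp add: R_def S_def algebra_simps flip: sum.distrib)
  ultimately show ?thesis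
    unfolding w_def[symmetric] z_def[symmetric] complex_norm_square[symmetric] by simp
qed

text \<open>The remainder has a nonnegative diagonal. For trace \<open>1\<close> this bounds the
  norm of the rank-one part by \<open>1\<close>.\<close>

lemma rank_one_part_norm_le:
  assumes "psd P"
  shows "(\<Sum>i\<in>UNIV. (cmod (rank_one_part P f i))\<^sup>2) \<le> Re (\<Sum>i\<in>UNIV. P i i)"
  unfolding Re_sum
proof (rule sum_mono)
  fix i
  have "0 \<le> Re (P i i - rank_one_part P f i * cnj (rank_one_part P f i))"
    using psd_diag_nonneg(1)[OF psd_diff_rank_one_part[OF assms]] .
  then show "(cmod (rank_one_part P f i))\<^sup>2 \<le> Re (P i i)"
    by (simp flip: complex_norm_square)
qed

text \<open>Write \<open>w = a f + x\<close> and \<open>z = b f + y\<close> with \<open>x\<close>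
  and \<open>y\<close> orthogonal to the unit vector \<open>f\<close>. Since \<open>f\<close> is
  real, the mixed terms of the bilinear sum vanish; Cauchy-Schwarz bounds the term with
  \<open>x\<close> and \<open>y\<close>.\<close>

lemma Re_sum_mult_ge:
  fixes f :: "'n::finite \<Rightarrow> real" and w z :: "'n \<Rightarrow> complex"
  assumes f: "(\<Sum>i\<in>UNIV. (f i)\<^sup>2) = 1"
    and w: "(\<Sum>i\<in>UNIV. of_real (f i) * w i) = complex_of_real a" "(\<Sum>i\<in>UNIV. (cmod (w i))\<^sup>2) \<le> 1"
    and z: "(\<Sum>i\<in>UNIV. of_real (f i) * z i) = complex_of_real b" "(\<Sum>i\<in>UNIV. (cmod (z i))\<^sup>2) \<le> 1"
  shows "a\<^sup>2 \<le> 1"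
    and "a * b - sqrt (1 - a\<^sup>2) * sqrt (1 - b\<^sup>2) \<le> Re (\<Sum>i\<in>UNIV. w i * z i)"
proof -
  have perp: "(\<Sum>i\<in>UNIV. (cmod (u i - of_real (c * f i)))\<^sup>2) \<le> 1 - c\<^sup>2"
    if u: "(\<Sum>i\<in>UNIV. of_real (f i) * u i) = complex_of_real c" "(\<Sum>i\<in>UNIV. (cmod (u i))\<^sup>2) \<le> 1" for u c
  proof -
    have "(\<Sum>i\<in>UNIV. (cmod (u i - of_real (c * f i)))\<^sup>2) =
        (\<Sum>i\<in>UNIV. (cmod (u i))\<^sup>2) - 2 * c * Re (\<Sum>i\<in>UNIV. of_real (f i) * u i) + c\<^sup>2 * (\<Sum>i\<in>UNIV. (f i)\<^sup>2)"
      unfolding cmod_power2 Re_sum sum_distrib_left sum_subtractf[symmetric] sum.distrib[symmetric]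
      by (intro sum.cong refl) (simp add: power2_eq_square algebra_simps)
    also have "\<dots> \<le> 1 - c\<^sup>2" using u f by (simp add: power2_eq_square)
    finally show ?thesis .
  qed
  have "0 \<le> 1 - a\<^sup>2"
    by (rule order_trans[OF _ perp[OF w]]) (intro sum_nonneg zero_le_power2)
  then show "a\<^sup>2 \<le> 1" by simp
  define x where "x i = w i - of_real (a * f i)" for i
  define y where "y i = z i - of_real (b * f i)" for i
  have "(\<Sum>i\<in>UNIV. w i * z i) = (\<Sum>i\<in>UNIV. x i * y i) + of_real b * (\<Sum>i\<in>UNIV. of_real (f i) * w i)
      + of_real a * (\<Sum>i\<in>UNIV. of_real (f i) * z i) - of_real (a * b * (\<Sum>i\<in>UNIV. (f i)\<^sup>2))"
    unfolding sum_distrib_left of_real_sum sum_subtractf[symmetric] sum.distrib[symmetric]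
    by (intro sum.cong refl) (simp add: x_def y_def power2_eq_square algebra_simps)
  then have "Re (\<Sum>i\<in>UNIV. w i * z i) = Re (\<Sum>i\<in>UNIV. x i * y i) + a * b"
    unfolding w z f by simp
  moreover have "\<bar>Re (\<Sum>i\<in>UNIV. x i * y i)\<bar> \<le> sqrt (1 - a\<^sup>2) * sqrt (1 - b\<^sup>2)"
  proof -
    have "\<bar>Re (\<Sum>i\<in>UNIV. x i * y i)\<bar> \<le> cmod (\<Sum>i\<in>UNIV. x i * y i)"
      by (rule abs_Re_le_cmod)
    also have "\<dots> \<le> (\<Sum>i\<in>UNIV. \<bar>cmod (x i)\<bar> * \<bar>cmod (y i)\<bar>)"
      by (rule order_trans[OF norm_sum]) (simp add: norm_mult)
    also have "\<dots> \<le> L2_set (\<lambda>i. cmod (x i)) UNIV * L2_set (\<lambda>i. cmod (y i)) UNIV"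
      by (rule L2_set_mult_ineq)
    also have "\<dots> \<le> sqrt (1 - a\<^sup>2) * sqrt (1 - b\<^sup>2)"
      using perp[OF w] perp[OF z] \<open>a\<^sup>2 \<le> 1\<close> unfolding L2_set_def x_def y_def
      by (intro mult_mono real_sqrt_le_mono) (auto intro!: sum_nonneg)
    finally show ?thesis .
  qed
  ultimately show "a * b - sqrt (1 - a\<^sup>2) * sqrt (1 - b\<^sup>2) \<le> Re (\<Sum>i\<in>UNIV. w i * z i)"
    by linarith
qed

text \<open>The square-root normalization makes the overlap with \<open>f\<close> real, which
  supplies the coefficients \<open>a\<close> and \<open>b\<close> of
  \<open>Re_sum_mult_ge\<close>.\<close>

lemma inner_rank_one_part_self:
  assumes "psd P"
  shows "(\<Sum>i\<in>UNIV. cnj (f i) * rank_one_part P f i) = complex_of_real (sqrt (Re (sform P f f)))"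
  unfolding inner_rank_one_part using psd_sform_self[OF assms, of f] psd_nonneg(1)[OF assms, of f]
  by (metis of_real_divide real_div_sqrt)

text \<open>If \<open>F P = cos\<^sup>2 \<alpha>\<close> and
  \<open>F Q = cos\<^sup>2 \<beta>\<close> with angles in \<open>[0, pi / 2]\<close>, the left side
  is \<open>cos (\<alpha> + \<beta>)\<close>.\<close>

lemma psd_overlap:
  fixes P Q :: "'n::finite \<Rightarrow> 'n \<Rightarrow> complex" and f :: "'n \<Rightarrow> real"
  defines "F R \<equiv> Re (sform R (\<lambda>i. of_real (f i)) (\<lambda>i. of_real (f i)))"
  assumes f: "(\<Sum>i\<in>UNIV. (f i)\<^sup>2) = 1"
    and P: "psd P" "(\<Sum>i\<in>UNIV. P i i) = 1" and Q: "psd Q" "(\<Sum>i\<in>UNIV. Q i i) = 1"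
  shows "F P \<le> 1"
    and "sqrt (F P) * sqrt (F Q) - sqrt (1 - F P) * sqrt (1 - F Q)
      \<le> sqrt (Re (\<Sum>i\<in>UNIV. \<Sum>j\<in>UNIV. P i j * Q i j))"
proof -
  let ?f = "\<lambda>i. complex_of_real (f i)"
  have ov: "(\<Sum>i\<in>UNIV. ?f i * rank_one_part R ?f i) = complex_of_real (sqrt (F R))"
    and tr: "(\<Sum>i\<in>UNIV. (cmod (rank_one_part R ?f i))\<^sup>2) \<le> 1"
    and nn: "0 \<le> F R" if "psd R" "(\<Sum>i\<in>UNIV. R i i) = 1" for R
    using inner_rank_one_part_self[OF that(1), of ?f] rank_one_part_norm_le[OF that(1), of ?f]
      psd_nonneg(1)[OF that(1), of ?f] that(2)
    by (simp_all add: F_def)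
  note ge = Re_sum_mult_ge[OF f ov[OF P] tr[OF P] ov[OF Q] tr[OF Q]]
  show "F P \<le> 1" using ge(1) nn[OF P] by simp
  have "sqrt (F P) * sqrt (F Q) - sqrt (1 - F P) * sqrt (1 - F Q)
      \<le> Re (\<Sum>i\<in>UNIV. rank_one_part P ?f i * rank_one_part Q ?f i)"
    using ge(2) nn[OF P] nn[OF Q] by simp
  also have "\<dots> \<le> cmod (\<Sum>i\<in>UNIV. rank_one_part P ?f i * rank_one_part Q ?f i)"
    by (rule complex_Re_le_cmod)
  also have "\<dots> \<le> sqrt (Re (\<Sum>i\<in>UNIV. \<Sum>j\<in>UNIV. P i j * Q i j))"
    by (rule real_le_rsqrt[OF psd_hadamard_sum_ge[OF P(1) Q(1)]])
  finally show "sqrt (F P) * sqrt (F Q) - sqrt (1 - F P) * sqrt (1 - F Q)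
      \<le> sqrt (Re (\<Sum>i\<in>UNIV. \<Sum>j\<in>UNIV. P i j * Q i j))" .
qed


lemma sum_UNIV_prod:
  fixes f :: "'a::finite \<times> 'b::finite \<Rightarrow> 'c::comm_monoid_add"
  shows "(\<Sum>p\<in>UNIV. f p) = (\<Sum>a\<in>UNIV. \<Sum>b\<in>UNIV. f (a, b))"
  unfolding UNIV_Times_UNIV[symmetric] by (rule sum.cartesian_product')

section \<open>Choi matrices and composition of channels\<close>

text \<open>
  The Choi matrix of \<open>E\<close>, scaled to have trace \<open>1\<close>: a pair \<open>(a, c)\<close> consists of an output
  index \<open>a\<close> and an input index \<open>c\<close>.
\<close>

definition choi :: "('d::finite cmat \<Rightarrow> 'd cmat) \<Rightarrow> 'd \<times> 'd \<Rightarrow> 'd \<times> 'd \<Rightarrow> complex" where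
  "choi E p q = E (eunit (snd p) (snd q)) $ fst p $ fst q / of_nat CARD('d)"

text \<open>The maximally entangled state.\<close>

definition mes :: "'d::finite \<times> 'd \<Rightarrow> real" where
  "mes p = (if fst p = snd p then 1 / sqrt (real CARD('d)) else 0)"

lemma mes_normalized: "(\<Sum>p\<in>(UNIV :: ('d::finite \<times> 'd) set). (mes p)\<^sup>2) = 1"
proof -
  have "(mes (a, b))\<^sup>2 = (if b = a then 1 / real CARD('d) else 0)" for a b :: 'd
    by (simp add: mes_def power_divide)
  then show ?thesis by (simp add: sum_UNIV_prod)
qed

text \<open>The \<open>\<chi>\<close>-matrix is the Choi matrix written in the orthonormal basis
  given by the entries of the \<open>B k\<close>, and \<open>B 0\<close> becomes
  \<open>mes\<close>.\<close>

lemma chi00_eq_sform_choi: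
  fixes B :: "nat \<Rightarrow> 'd::finite cmat"
  assumes B: "trace_orthonormal_basis B" and E: "Vector_Spaces.linear cscale cscale E"
  shows "chi_matrix B E 0 0 = sform (choi E) (\<lambda>p. of_real (mes p)) (\<lambda>p. of_real (mes p))"
proof -
  define K where "K = {..<CARD('d)\<^sup>2}"
  define u where "u k p = B k $ fst p $ snd p" for k and p :: "'d \<times> 'd"
  have K: "finite K" "0 \<in> K" by (simp_all add: K_def)
  have orth: "(\<Sum>p\<in>UNIV. cnj (u j p) * u k p) = (if j = k then 1 else 0)" if "j \<in> K" "k \<in> K" for j k
    using B that unfolding trace_orthonormal_basis_def trace_dagger_mult u_def K_def by auto
  have "is_chi_matrix B E (chi_matrix B E)"
    unfolding chi_matrix_def by (rule theI'[OF ex1_chi_matrix[OF B E]])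
  then have "choi E p q = (\<Sum>k\<in>K. \<Sum>l\<in>K. chi_matrix B E k l * (u k p * cnj (u l q)))" for p q
    unfolding is_chi_matrix_def chi_expansion_iff[OF E] choi_def u_def K_def by blast
  then have "(\<Sum>p\<in>UNIV. \<Sum>q\<in>UNIV. choi E p q * (cnj (u 0 p) * u 0 q)) = chi_matrix B E 0 0"
    by (intro change_of_basis[where K = K] orth K) simp_all
  moreover have "u 0 p = of_real (mes p)" for p
    using B by (simp add: trace_orthonormal_basis_def u_def mat_def mes_def)
  ultimately show ?thesis
    by (simp add: sform_def ac_simps)
qed

text \<open>The form at \<open>mes\<close> only sees pairs with equal components. Compositions and
  phase channels are evaluated through this basis-free expression.\<close>

lemma chi00_eq:
  fixes B :: "nat \<Rightarrow> 'd::finite cmat"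
  assumes "trace_orthonormal_basis B" and "Vector_Spaces.linear cscale cscale E"
  shows "chi_matrix B E 0 0 =
    (\<Sum>a\<in>UNIV. \<Sum>b\<in>UNIV. E (eunit a b) $ a $ b) / (of_nat CARD('d))\<^sup>2"
proof -
  have m: "complex_of_real (mes (a, c)) = (if a = c then 1 / complex_of_real (sqrt (real CARD('d))) else 0)" for a c :: 'd
    by (simp add: mes_def)
  have "(\<Sum>q\<in>UNIV. choi E (a, c) q * of_real (mes q)) =
      (\<Sum>b\<in>UNIV. choi E (a, c) (b, b)) / complex_of_real (sqrt (real CARD('d)))" for a c
    by (simp add: sum_UNIV_prod m if_distrib sum_divide_distrib cong: if_cong)
  then have "sform (choi E) (\<lambda>p. of_real (mes p)) (\<lambda>p. of_real (mes p)) =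
      (\<Sum>a\<in>UNIV. \<Sum>c\<in>UNIV. of_real (mes (a, c)) *
        ((\<Sum>b\<in>UNIV. choi E (a, c) (b, b)) / complex_of_real (sqrt (real CARD('d)))))"
    unfolding sform_def mult.assoc sum_distrib_left[symmetric]
    by (subst sum_UNIV_prod) simp
  also have "\<dots> = (\<Sum>a\<in>UNIV. \<Sum>b\<in>UNIV. choi E (a, a) (b, b)) / of_nat CARD('d)"
    by (simp add: m if_distrib[of "\<lambda>x. x * _"] sum_divide_distrib flip: of_real_mult cong: if_cong)
  finally show ?thesis
    by (simp add: chi00_eq_sform_choi[OF assms] choi_def power2_eq_square flip: sum_divide_distrib)
qed

text \<open>Up to the factor \<open>1 / d\<close>, the Choi matrix is the image under
  \<open>id \<otimes> E\<close> of the block matrix of all matrix units.\<close>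

lemma psd_choi:
  fixes E :: "'d::finite cmat \<Rightarrow> 'd cmat"
  assumes "completely_positive E"
  shows "psd (choi E)"
proof -
  \<comment> \<open>Blocks are indexed by naturals, so \<open>h\<close> enumerates the index
    type.\<close>
  obtain h where h: "bij_betw h {..<CARD('d)} (UNIV :: 'd set)"
    using finite_same_card_bij[of "{..<CARD('d)}" "UNIV :: 'd set"] by auto
  have "block_psd CARD('d) (\<lambda>i j. eunit (h i) (h j))"
    unfolding block_psd_def
  proof
    fix v :: "nat \<Rightarrow> complex^'d"
    have *: "(eunit c e *v x) $ a = (if a = c then x $ e else 0)" for c e a :: 'd and x
      by (cases "a = c") (simp_all add: matrix_vector_mult_def eunit_def if_distrib[of "\<lambda>x. x * _"] cong: if_cong)
    \<comment> \<open>The block matrix of units has rank one, so its form is a squared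
      modulus.\<close>
    have "(\<Sum>i<CARD('d). \<Sum>j<CARD('d). \<Sum>a\<in>UNIV. cnj (v i $ a) * (eunit (h i) (h j) *v v j) $ a) =
        (\<Sum>j<CARD('d). v j $ h j) * cnj (\<Sum>i<CARD('d). v i $ h i)"
      unfolding sum_product cnj_sum * by (subst sum.swap) (simp add: if_distrib mult.commute cong: if_cong)
    then show "(\<Sum>i<CARD('d). \<Sum>j<CARD('d). \<Sum>a\<in>UNIV. cnj (v i $ a) * (eunit (h i) (h j) *v v j) $ a) \<in> \<real>\<^sub>\<ge>\<^sub>0"
      by (simp only: complex_norm_square[symmetric]) simp
  qed
  then have psd: "block_psd CARD('d) (\<lambda>i j. E (eunit (h i) (h j)))"
    using assms by (simp add: completely_positive_def)
  show ?thesis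
    unfolding psd_def
  proof
    fix v :: "'d \<times> 'd \<Rightarrow> complex"
    have re: "(\<Sum>i<CARD('d). g (h i)) = (\<Sum>c\<in>UNIV. g c)" for g :: "'d \<Rightarrow> complex"
      by (rule sum.reindex_bij_betw[OF h])
    have "sform (choi E) v v = (\<Sum>a\<in>UNIV. \<Sum>c\<in>UNIV. \<Sum>b\<in>UNIV. \<Sum>e\<in>UNIV.
        cnj (v (a, c)) * (E (eunit c e) $ a $ b) * v (b, e)) / of_nat CARD('d)"
      by (simp add: sform_def choi_def sum_UNIV_prod sum_divide_distrib)
    also have "(\<Sum>a\<in>UNIV. \<Sum>c\<in>UNIV. \<Sum>b\<in>UNIV. \<Sum>e\<in>UNIV. cnj (v (a, c)) * (E (eunit c e) $ a $ b) * v (b, e)) =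
        (\<Sum>c\<in>UNIV. \<Sum>a\<in>UNIV. \<Sum>e\<in>UNIV. \<Sum>b\<in>UNIV. cnj (v (a, c)) * (E (eunit c e) $ a $ b) * v (b, e))"
      by (subst sum.swap) (intro sum.cong refl sum.swap)
    also have "\<dots> = (\<Sum>c\<in>UNIV. \<Sum>e\<in>UNIV. \<Sum>a\<in>UNIV. \<Sum>b\<in>UNIV. cnj (v (a, c)) * (E (eunit c e) $ a $ b) * v (b, e))"
      by (intro sum.cong refl sum.swap)
    also have "\<dots> = (\<Sum>i<CARD('d). \<Sum>j<CARD('d). \<Sum>a\<in>UNIV.
        cnj ((\<chi> a. v (a, h i)) $ a) * (E (eunit (h i) (h j)) *v (\<chi> a. v (a, h j))) $ a)"
      by (simp add: re[symmetric] matrix_vector_mult_def sum_distrib_left mult.assoc)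
    finally show "sform (choi E) v v \<in> \<real>\<^sub>\<ge>\<^sub>0"
      using psd[unfolded block_psd_def, THEN spec, of "\<lambda>i. \<chi> a. v (a, h i)"]
      by (simp only: nonneg_Reals_divide_I nonneg_Reals_of_nat_I)
  qed
qed

lemma trace_choi:
  fixes E :: "'d::finite cmat \<Rightarrow> 'd cmat"
  assumes "trace_preserving E"
  shows "(\<Sum>p\<in>UNIV. choi E p p) = 1"
proof -
  have "trace (eunit c c :: 'd cmat) = 1" for c
    by (simp add: trace_def eunit_def)
  then have "(\<Sum>a\<in>UNIV. E (eunit c c) $ a $ a) = 1" for c
    using assms by (simp add: trace_preserving_def trace_def)
  moreover have "(\<Sum>p\<in>UNIV. choi E p p) = (\<Sum>c\<in>UNIV. \<Sum>a\<in>UNIV. E (eunit c c) $ a $ a) / of_nat CARD('d)"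
    by (subst sum.swap) (simp add: choi_def sum_UNIV_prod sum_divide_distrib)
  ultimately show ?thesis by simp
qed

text \<open>The swap matches the output index of \<open>F\<close> with the input index of \<open>E\<close>.\<close>

lemma chi00_comp:
  fixes B :: "nat \<Rightarrow> 'd::finite cmat"
  assumes B: "trace_orthonormal_basis B"
    and E: "Vector_Spaces.linear cscale cscale E" and F: "Vector_Spaces.linear cscale cscale F"
  shows "chi_matrix B (E \<circ> F) 0 0 =
    (\<Sum>p\<in>UNIV. \<Sum>q\<in>UNIV. choi E p q * choi F (prod.swap p) (prod.swap q))"
proof -
  have "Vector_Spaces.linear cscale cscale (E \<circ> F)"
    using F E by (rule Vector_Spaces.linear_compose)
  then have "chi_matrix B (E \<circ> F) 0 0 = (\<Sum>a\<in>UNIV. \<Sum>b\<in>UNIV. \<Sum>c\<in>UNIV. \<Sum>e\<in>UNIV.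
      F (eunit a b) $ c $ e * E (eunit c e) $ a $ b) / (of_nat CARD('d))\<^sup>2"
    by (simp add: chi00_eq[OF B] linear_nth[OF E, of "F _"])
  also have "\<dots> = (\<Sum>a\<in>UNIV. \<Sum>c\<in>UNIV. \<Sum>b\<in>UNIV. \<Sum>e\<in>UNIV.
      F (eunit a b) $ c $ e * E (eunit c e) $ a $ b) / (of_nat CARD('d))\<^sup>2"
    by (intro arg_cong2[where f = "(/)"] sum.cong refl sum.swap)
  finally show ?thesis
    by (simp add: choi_def sum_UNIV_prod sum_divide_distrib
          power2_eq_square mult.commute)
qed

lemma chi00_range:
  fixes B :: "nat \<Rightarrow> 'd::finite cmat"
  assumes B: "trace_orthonormal_basis B" and E: "quantum_channel E"
  shows "0 \<le> Re (chi_matrix B E 0 0)" and "Re (chi_matrix B E 0 0) \<le> 1"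
proof -
  have lin: "Vector_Spaces.linear cscale cscale E"
    and psd: "psd (choi E)" and tr: "(\<Sum>p\<in>UNIV. choi E p p) = 1"
    using E by (simp_all add: quantum_channel_def psd_choi trace_choi)
  show "0 \<le> Re (chi_matrix B E 0 0)"
    unfolding chi00_eq_sform_choi[OF B lin] by (rule psd_nonneg[OF psd])
  show "Re (chi_matrix B E 0 0) \<le> 1"
    unfolding chi00_eq_sform_choi[OF B lin] by (rule psd_overlap(1)[OF mes_normalized psd tr psd tr])
qed

text \<open>\<open>mes\<close> is symmetric in its two indices, so exchanging input and output
  preserves this overlap.\<close>

lemma sform_choi_swap:
  "sform (\<lambda>p q. choi F (prod.swap p) (prod.swap q)) (\<lambda>p. of_real (mes p)) (\<lambda>p. of_real (mes p)) =
     sform (choi F) (\<lambda>p. of_real (mes p)) (\<lambda>p. of_real (mes p))"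
proof -
  have "mes (prod.swap p) = mes p" for p :: "'a \<times> 'a" by (simp add: mes_def)
  then show ?thesis
    using sform_reindex[OF bij_swap, of "choi F" "\<lambda>p. of_real (mes p)" "\<lambda>p. of_real (mes p)"] by simp
qed

text \<open>This is \<open>psd_overlap\<close> for \<open>choi E\<close> and the swapped
  \<open>choi F\<close>, read through the addition formula for cosine.\<close>

lemma chi00_comp_ge:
  fixes B :: "nat \<Rightarrow> 'd::finite cmat"
  defines "angle E \<equiv> arccos (sqrt (Re (chi_matrix B E 0 0)))"
  assumes B: "trace_orthonormal_basis B" and E: "quantum_channel E" and F: "quantum_channel F"
  shows "cos (angle E + angle F) \<le> sqrt (Re (chi_matrix B (E \<circ> F) 0 0))"
proof -
  have lin: "Vector_Spaces.linear cscale cscale E" "Vector_Spaces.linear cscale cscale F"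
    and psd: "psd (choi E)" "psd (choi F)"
    and tr: "(\<Sum>p\<in>UNIV. choi E p p) = 1" "(\<Sum>p\<in>UNIV. choi F p p) = 1"
    using E F by (simp_all add: quantum_channel_def psd_choi trace_choi)
  have trQ: "(\<Sum>p\<in>UNIV. choi F (prod.swap p) (prod.swap p)) = 1"
    using tr(2) sum.reindex_bij_betw[OF bij_swap, of "\<lambda>p. choi F p p"] by simp
  let ?e = "Re (chi_matrix B E 0 0)" and ?f = "Re (chi_matrix B F 0 0)"
  have "- 1 \<le> sqrt ?e" "sqrt ?e \<le> 1" "- 1 \<le> sqrt ?f" "sqrt ?f \<le> 1" "0 \<le> ?e" "0 \<le> ?f"
    using chi00_range[OF B E] chi00_range[OF B F] by (auto intro: order_trans[of _ 0])
  then have "cos (angle E + angle F) = sqrt ?e * sqrt ?f - sqrt (1 - ?e) * sqrt (1 - ?f)"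
    unfolding angle_def by (simp add: cos_add cos_arccos sin_arccos)
  also have "\<dots> \<le> sqrt (Re (chi_matrix B (E \<circ> F) 0 0))"
    using psd_overlap(2)[OF mes_normalized psd(1) tr(1) psd_reindex[OF psd(2) bij_swap] trQ]
    unfolding chi00_comp[OF B lin] chi00_eq_sform_choi[OF B lin(1)] chi00_eq_sform_choi[OF B lin(2)]
      sform_choi_swap .
  finally show ?thesis .
qed

lemma quantum_channel_id: "quantum_channel id"
  using vector_space.linear_id[OF vector_space_cscale]
  by (simp add: quantum_channel_def completely_positive_def trace_preserving_def)

lemma quantum_channel_comp:
  "quantum_channel E \<Longrightarrow> quantum_channel F \<Longrightarrow> quantum_channel (E \<circ> F)"
  by (auto simp: quantum_channel_def completely_positive_def trace_preserving_def intro: Vector_Spaces.linear_compose)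

lemma quantum_channel_compose_channels:
  "(\<And>i. i \<in> {1..m} \<Longrightarrow> quantum_channel (X i)) \<Longrightarrow> quantum_channel (compose_channels X m)"
  by (induction m) (simp_all add: quantum_channel_id quantum_channel_comp)

section \<open>Diagonal unitary channels\<close>

text \<open>Conjugation of \<open>\<rho>\<close> by the diagonal matrix with entries
  \<open>u a\<close>.\<close>

definition phase_channel :: "('d::finite \<Rightarrow> complex) \<Rightarrow> 'd cmat \<Rightarrow> 'd cmat" where
  "phase_channel u \<rho> = (\<chi> a b. u a * cnj (u b) * \<rho> $ a $ b)"

lemma linear_phase_channel: "Vector_Spaces.linear cscale cscale (phase_channel u)"
  unfolding linear_iff_module_hom module_hom_iff
  using vector_space_cscale
  by (simp add: phase_channel_def vec_eq_iff algebra_simps module_iff_vector_space)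

lemma quantum_channel_phase_channel:
  assumes "\<And>a. cmod (u a) = 1"
  shows "quantum_channel (phase_channel u)"
  unfolding quantum_channel_def
proof (intro conjI linear_phase_channel)
  have "u a * cnj (u a) = 1" for a
    using assms[of a] by (simp flip: complex_norm_square)
  then show "trace_preserving (phase_channel u)"
    by (simp add: trace_preserving_def trace_def phase_channel_def)
  show "completely_positive (phase_channel u)"
    unfolding completely_positive_def block_psd_def
  proof (intro allI impI)
    fix n and M :: "nat \<Rightarrow> nat \<Rightarrow> 'a cmat" and v :: "nat \<Rightarrow> complex^'a"
    assume "\<forall>v. (\<Sum>i<n. \<Sum>j<n. \<Sum>a\<in>UNIV. cnj (v i $ a) * (M i j *v v j) $ a) \<in> \<real>\<^sub>\<ge>\<^sub>0"
    \<comment> \<open>The conjugation moves to the vectors: the adjoint of the diagonal matrix acts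
      on each block \<open>v i\<close>.\<close>
    then have "(\<Sum>i<n. \<Sum>j<n. \<Sum>a\<in>UNIV. cnj ((\<chi> a. cnj (u a) * v i $ a) $ a) *
        (M i j *v (\<chi> a. cnj (u a) * v j $ a)) $ a) \<in> \<real>\<^sub>\<ge>\<^sub>0"
      by (rule spec)
    then show "(\<Sum>i<n. \<Sum>j<n. \<Sum>a\<in>UNIV. cnj (v i $ a) * (phase_channel u (M i j) *v v j) $ a) \<in> \<real>\<^sub>\<ge>\<^sub>0"
      by (simp add: phase_channel_def matrix_vector_mult_def sum_distrib_left ac_simps)
  qed
qed

lemma chi00_phase_channel:
  fixes B :: "nat \<Rightarrow> 'd::finite cmat"
  assumes "trace_orthonormal_basis B"
  shows "chi_matrix B (phase_channel u) 0 0 = complex_of_real ((cmod (\<Sum>a\<in>UNIV. u a) / real CARD('d))\<^sup>2)"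
proof -
  have "(\<Sum>a\<in>UNIV. \<Sum>b\<in>UNIV. phase_channel u (eunit a b) $ a $ b) = (\<Sum>a\<in>UNIV. u a) * cnj (\<Sum>a\<in>UNIV. u a)"
    by (simp add: phase_channel_def eunit_def sum_product)
  also have "\<dots> = complex_of_real ((cmod (\<Sum>a\<in>UNIV. u a))\<^sup>2)"
    by (simp only: complex_norm_square)
  finally show ?thesis
    by (simp add: chi00_eq[OF assms linear_phase_channel] power_divide)
qed

lemma phase_channel_comp: "phase_channel u \<circ> phase_channel v = phase_channel (\<lambda>a. u a * v a)"
  by (simp add: fun_eq_iff phase_channel_def vec_eq_iff ac_simps)

lemma phase_channel_1: "phase_channel (\<lambda>a. 1) = id"
  by (simp add: fun_eq_iff phase_channel_def vec_eq_iff)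

lemma compose_phase_channels:
  "compose_channels (\<lambda>i. phase_channel (\<lambda>a. cis (\<theta> i * s a))) m =
     phase_channel (\<lambda>a. cis ((\<Sum>i=1..m. \<theta> i) * s a))"
  by (induction m) (simp_all add: phase_channel_1 phase_channel_comp cis_mult distrib_right)

text \<open>Each sign occurs \<open>d / 2\<close> times, so the sines cancel and the cosines add
  up.\<close>

lemma sum_cis_balanced:
  fixes S :: "'d::finite set"
  assumes "2 * card S = CARD('d)"
  shows "(\<Sum>a\<in>UNIV. cis (t * (if a \<in> S then 1 else - 1))) = complex_of_real (real CARD('d) * cos t)"
proof -
  have "(\<Sum>a\<in>UNIV. cis (t * (if a \<in> S then 1 else - 1))) = (\<Sum>a\<in>UNIV. if a \<in> S then cis t else cis (- t))"
    by (intro sum.cong) simp_all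
  also have "\<dots> = of_nat (card S) * cis t + of_nat (card (- S)) * cis (- t)"
    by (simp add: sum.If_cases Compl_eq)
  also have "card (- S) = card S"
    using assms by (simp add: Compl_eq_Diff_UNIV card_Diff_subset)
  finally show ?thesis
    using assms[symmetric] by (simp add: complex_eq_iff)
qed

lemma chi00_balanced_phase_channel:
  fixes B :: "nat \<Rightarrow> 'd::finite cmat" and S :: "'d set"
  assumes "trace_orthonormal_basis B" and "2 * card S = CARD('d)"
  shows "chi_matrix B (phase_channel (\<lambda>a. cis (t * (if a \<in> S then 1 else - 1)))) 0 0
    = complex_of_real ((cos t)\<^sup>2)"
  unfolding chi00_phase_channel[OF assms(1)] sum_cis_balanced[OF assms(2)]
  by (simp add: norm_mult power_divide power_mult_distrib)

section \<open>Any number of channels: induction and attainment\<close>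

theorem corollary2:
  fixes B :: "nat \<Rightarrow> complex^'d::finite^'d" and m :: nat
  assumes "CARD('d) \<ge> 2" and "m \<ge> 1" and "trace_orthonormal_basis B"
  shows "(\<forall>X :: nat \<Rightarrow> complex^'d^'d \<Rightarrow> complex^'d^'d.
            (\<forall>i\<in>{1..m}. quantum_channel (X i)) \<and>
            (\<Sum>i=1..m. arccos (sqrt (Re (chi_matrix B (X i) 0 0)))) \<le> pi / 2 \<longrightarrow>
            Re (chi_matrix B (compose_channels X m) 0 0)
              \<ge> (cos (\<Sum>i=1..m. arccos (sqrt (Re (chi_matrix B (X i) 0 0)))))\<^sup>2) \<and>
         (even CARD('d) \<longrightarrow>
           (\<forall>a :: nat \<Rightarrow> real.
              (\<forall>i\<in>{1..m}. 0 \<le> a i \<and> a i \<le> 1) \<and>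
              (\<Sum>i=1..m. arccos (sqrt (a i))) \<le> pi / 2 \<longrightarrow>
              (\<exists>X :: nat \<Rightarrow> complex^'d^'d \<Rightarrow> complex^'d^'d.
                 (\<forall>i\<in>{1..m}. quantum_channel (X i)) \<and>
                 (\<forall>i\<in>{1..m}. chi_matrix B (X i) 0 0 = complex_of_real (a i)) \<and>
                 chi_matrix B (compose_channels X m) 0 0
                   = complex_of_real ((cos (\<Sum>i=1..m. arccos (sqrt (a i))))\<^sup>2))))"
proof (intro conjI allI impI)
  fix X :: "nat \<Rightarrow> complex^'d^'d \<Rightarrow> complex^'d^'d"
  define angle where "angle E = arccos (sqrt (Re (chi_matrix B E 0 0)))" for E
  have nonneg: "0 \<le> angle E" if "quantum_channel E" for E
    unfolding angle_def using chi00_range[OF assms(3) that]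
    by (intro arccos_lbound) (auto intro: order_trans[of _ 0])
  assume "(\<forall>i\<in>{1..m}. quantum_channel (X i)) \<and>
    (\<Sum>i=1..m. arccos (sqrt (Re (chi_matrix B (X i) 0 0)))) \<le> pi / 2"
  then have "\<forall>i\<in>{1..m}. quantum_channel (X i)" "(\<Sum>i=1..m. angle (X i)) \<le> pi / 2"
    by (simp_all add: angle_def)
  then have "(cos (\<Sum>i=1..m. angle (X i)))\<^sup>2 \<le> Re (chi_matrix B (compose_channels X m) 0 0)"
  proof (induction m)
    case 0
    \<comment> \<open>The empty composition is the channel with all phases \<open>1\<close>, where
      the bound reads \<open>1 \<le> 1\<close>.\<close>
    have "chi_matrix B (phase_channel (\<lambda>a. 1)) 0 0 = 1"
      unfolding chi00_phase_channel[OF assms(3)] by simp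
    then show ?case by (simp add: phase_channel_1 id_def)
  next
    case (Suc m)
    let ?C = "compose_channels X m" and ?s = "\<Sum>i=1..m. angle (X i)"
    have ch: "quantum_channel ?C" "quantum_channel (X (Suc m))"
      using Suc.prems(1) by (auto intro!: quantum_channel_compose_channels)
    have s: "0 \<le> ?s" "?s + angle (X (Suc m)) \<le> pi / 2"
      using Suc.prems by (auto intro!: sum_nonneg nonneg)
    have le: "?s \<le> pi / 2" using s nonneg[OF ch(2)] by linarith
    have "(cos ?s)\<^sup>2 \<le> Re (chi_matrix B ?C 0 0)"
      using Suc le by simp
    then have "cos ?s \<le> sqrt (Re (chi_matrix B ?C 0 0))"
      by (rule real_le_rsqrt)
    \<comment> \<open>As \<open>arccos\<close> is decreasing, the induction hypothesis says that the
      angle of the composition is at most the sum of the angles.\<close>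
    then have "angle ?C \<le> arccos (cos ?s)"
      unfolding angle_def using chi00_range[OF assms(3) ch(1)]
      by (intro arccos_le_arccos) simp_all
    also have "\<dots> = ?s"
      using s(1) le by (intro arccos_cos) linarith+
    finally have a: "angle ?C \<le> ?s" .
    have "cos (?s + angle (X (Suc m))) \<le> cos (angle ?C + angle (X (Suc m)))"
      using a s nonneg[OF ch(1)] nonneg[OF ch(2)] pi_ge_zero by (intro cos_monotone_0_pi_le) linarith+
    also have "\<dots> \<le> sqrt (Re (chi_matrix B (?C \<circ> X (Suc m)) 0 0))"
      unfolding angle_def by (rule chi00_comp_ge[OF assms(3) ch])
    finally have "cos (?s + angle (X (Suc m))) \<le> sqrt (Re (chi_matrix B (?C \<circ> X (Suc m)) 0 0))" .
    \<comment> \<open>Squaring needs a nonnegative cosine, which the bound \<open>pi / 2\<close> on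
      the total angle guarantees.\<close>
    moreover have "0 \<le> cos (?s + angle (X (Suc m)))"
      using s nonneg[OF ch(2)] pi_ge_zero by (intro cos_ge_zero) linarith+
    ultimately have "(cos (?s + angle (X (Suc m))))\<^sup>2 \<le> (sqrt (Re (chi_matrix B (?C \<circ> X (Suc m)) 0 0)))\<^sup>2"
      by (rule power_mono)
    also have "\<dots> = Re (chi_matrix B (?C \<circ> X (Suc m)) 0 0)"
      using chi00_range(1)[OF assms(3) quantum_channel_comp[OF ch]] by simp
    finally show ?case by (simp add: comp_def)
  qed
  then show "(cos (\<Sum>i=1..m. arccos (sqrt (Re (chi_matrix B (X i) 0 0)))))\<^sup>2
      \<le> Re (chi_matrix B (compose_channels X m) 0 0)"
    by (simp add: angle_def)
next
  fix a :: "nat \<Rightarrow> real"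
  assume "even CARD('d)" and a: "(\<forall>i\<in>{1..m}. 0 \<le> a i \<and> a i \<le> 1) \<and>
    (\<Sum>i=1..m. arccos (sqrt (a i))) \<le> pi / 2"
  have "CARD('d) div 2 \<le> CARD('d)" by simp
  then obtain S :: "'d set" where "card S = CARD('d) div 2"
    by (metis obtain_subset_with_card_n)
  with \<open>even CARD('d)\<close> have S: "2 * card S = CARD('d)" by simp
  \<comment> \<open>The diagonal of \<open>Z\<close>, balanced because \<open>S\<close> contains
    half of the indices.\<close>
  define s :: "'d \<Rightarrow> real" where "s b = (if b \<in> S then 1 else - 1)" for b
  \<comment> \<open>Each angle has squared cosine \<open>a i\<close>; since all channels share
    \<open>s\<close>, the angles add under composition.\<close>
  define X where "X i = phase_channel (\<lambda>b. cis (arccos (sqrt (a i)) * s b))" for i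
  have "chi_matrix B (X i) 0 0 = complex_of_real (a i)" if "i \<in> {1..m}" for i
  proof -
    have "0 \<le> a i" "a i \<le> 1" using a that by auto
    then have "cos (arccos (sqrt (a i))) = sqrt (a i)"
      by (intro cos_arccos) (auto intro: order_trans[of _ 0])
    then show ?thesis
      using \<open>0 \<le> a i\<close> unfolding X_def s_def chi00_balanced_phase_channel[OF assms(3) S] by simp
  qed
  moreover have "quantum_channel (X i)" for i
    unfolding X_def by (rule quantum_channel_phase_channel) simp
  moreover have "chi_matrix B (compose_channels X m) 0 0 =
      complex_of_real ((cos (\<Sum>i=1..m. arccos (sqrt (a i))))\<^sup>2)"
    unfolding X_def compose_phase_channels s_def by (rule chi00_balanced_phase_channel[OF assms(3) S])
  ultimately show "\<exists>X. (\<forall>i\<in>{1..m}. quantum_channel (X i)) \<and>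
      (\<forall>i\<in>{1..m}. chi_matrix B (X i) 0 0 = complex_of_real (a i)) \<and>
      chi_matrix B (compose_channels X m) 0 0 = complex_of_real ((cos (\<Sum>i=1..m. arccos (sqrt (a i))))\<^sup>2)"
    by blast
qed

end
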